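(* Let $\alpha\in(0,1)$ be irrational with continued fraction expansion $\alpha=[a_0;a_1,a_2,\ldots]$, and let $s_\alpha$ be a Sturmian word of angle $\alpha$. Then $$A(s_\alpha)=\limsup_{i\to\infty}\big([a_{i+1};a_{i+2},a_{i+3},\ldots]+[0;a_i,a_{i-1},\ldots,a_1]\big).$$
   Context: $[a_0;a_1,a_2,\ldots]$ denotes the simple continued fraction $a_0+1/(a_1+1/(a_2+\cdots))$, finite or infinite. $\{x\}=x-\lfloor x\rfloor$ is the fractional part. For irrational $\alpha\in(0,1)$ and $\rho\in[0,1)$, a Sturmian word of angle $\alpha$ and initial point $\rho$ is the infinite word $c_0c_1c_2\cdots$ over $\{a,b\}$ with $c_n=b$ if $\{\rho+n\alpha\}\in I_b$ and $c_n=a$ if $\{\rho+n\alpha\}\in I_a$, where either $I_b=[0,1-\alpha)$, $I_a=[1-\alpha,1)$, or $I_b=(0,1-\alpha]$, $I_a=(1-\alpha,1]$ with $0$ identified with $1$. $s_\alpha$ denotes any Sturmian word of angle $\alpha$. The Parikh vector $\mathcal{P}$ of a word over $\{a,b\}$ is the pair (number of $a$'s, number of $b$'s), with norm $|\mathcal P|$ the sum of its components. $\mathcal{P}$ is contained in $\mathcal{Q}$ if $|\mathcal P|<|\mathcal Q|$ and $\mathcal P\leq\mathcal Q$ componentwise. A word $w$ is an abelian power of period $m$ and exponent $k$ if $w=u_1\cdots u_k$ where all $u_i$ have length $m$ and the same Parikh vector. A word $w$ is an abelian repetition of period $m$ and exponent $|w|/m$ if $w=u_0u_1\cdots u_{j-1}u_j$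 with $j\geq3$, where $u_1,\dots,u_{j-1}$ have length $m$ and the same Parikh vector $\mathcal P$, and the Parikh vectors of $u_0$ and $u_j$ (possibly empty words) are contained in $\mathcal P$. For $m>1$ let $k_m$ (resp. $k'_m$) be the maximum exponent of an abelian power (resp. abelian repetition) of period $m$ that is a factor of $s_\alpha$. The abelian critical exponent of $s_\alpha$ is $A(s_\alpha)=\limsup_{m\to\infty}k_m/m=\limsup_{m\to\infty}k'_m/m\in[0,\infty]$ (the two coincide since $k_m\leq k'_m<k_m+2$). *)

theory Defs
  imports "HOL-Analysis.Analysis"
begin

fun cfrac_fin :: "int list \<Rightarrow> real" where
  "cfrac_fin [] = 0"
| "cfrac_fin [x] = of_int x"
| "cfrac_fin (x # y # ys) = of_int x + 1 / cfrac_fin (y # ys)"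

text \<open>The limit exists whenever all partial quotients \<open>a i\<close> with \<open>i \<ge> 1\<close> are positive, which is
  the only case in which this is used.\<close>

definition cfrac_inf :: "(nat \<Rightarrow> int) \<Rightarrow> real" where
  "cfrac_inf a = lim (\<lambda>n. cfrac_fin (map a [0..<Suc n]))"

datatype letter = La | Lb

definition sturmian_lower :: "real \<Rightarrow> real \<Rightarrow> nat \<Rightarrow> letter" where
  "sturmian_lower \<alpha> \<rho> n = (if frac (\<rho> + real n * \<alpha>) \<in> {0..<1 - \<alpha>} then Lb else La)"

text \<open>For the intervals \<open>(0, 1 - \<alpha>]\<close> and \<open>(1 - \<alpha>, 1]\<close> the point \<open>0\<close> is identified
  with \<open>1\<close>, so fractional part \<open>0\<close> yields the letter \<open>La\<close>.\<close>

definition sturmian_upper :: "real \<Rightarrow> real \<Rightarrow> nat \<Rightarrow> letter" where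
  "sturmian_upper \<alpha> \<rho> n = (if frac (\<rho> + real n * \<alpha>) \<in> {0<..1 - \<alpha>} then Lb else La)"

definition is_sturmian :: "real \<Rightarrow> (nat \<Rightarrow> letter) \<Rightarrow> bool" where
  "is_sturmian \<alpha> s \<longleftrightarrow> (\<exists>\<rho>\<in>{0..<1}. s = sturmian_lower \<alpha> \<rho> \<or> s = sturmian_upper \<alpha> \<rho>)"

definition is_factor :: "letter list \<Rightarrow> (nat \<Rightarrow> letter) \<Rightarrow> bool" where
  "is_factor w s \<longleftrightarrow> (\<exists>i. w = map s [i..<i + length w])"

definition parikh :: "letter list \<Rightarrow> nat \<times> nat" where
  "parikh w = (count_list w La, count_list w Lb)"

definition parikh_norm :: "nat \<times> nat \<Rightarrow> nat" where
  "parikh_norm P = fst P + snd P"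

definition parikh_contained :: "nat \<times> nat \<Rightarrow> nat \<times> nat \<Rightarrow> bool" where
  "parikh_contained P Q \<longleftrightarrow> parikh_norm P < parikh_norm Q \<and> fst P \<le> fst Q \<and> snd P \<le> snd Q"

definition abelian_power :: "nat \<Rightarrow> nat \<Rightarrow> letter list \<Rightarrow> bool" where
  "abelian_power m k w \<longleftrightarrow>
     (\<exists>us P. k \<ge> 1 \<and> length us = k \<and> w = concat us \<and>
        (\<forall>u\<in>set us. length u = m \<and> parikh u = P))"

text \<open>The list \<open>us\<close> holds the inner blocks \<open>u\<^sub>1, \<dots>, u\<^sub>j\<^sub>-\<^sub>1\<close>, so the condition
  \<open>j \<ge> 3\<close> becomes \<open>length us \<ge> 2\<close>.\<close>

definition abelian_repetition :: "nat \<Rightarrow> real \<Rightarrow> letter list \<Rightarrow> bool" where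
  "abelian_repetition m e w \<longleftrightarrow>
     e = real (length w) / real m \<and>
     (\<exists>u us v P. w = u @ concat us @ v \<and> length us \<ge> 2 \<and>
        (\<forall>x\<in>set us. length x = m \<and> parikh x = P) \<and>
        parikh_contained (parikh u) P \<and> parikh_contained (parikh v) P)"

definition power_exponents :: "(nat \<Rightarrow> letter) \<Rightarrow> nat \<Rightarrow> nat set" where
  "power_exponents s m = {k. \<exists>w. is_factor w s \<and> abelian_power m k w}"

definition repetition_exponents :: "(nat \<Rightarrow> letter) \<Rightarrow> nat \<Rightarrow> real set" where
  "repetition_exponents s m = {e. \<exists>w. is_factor w s \<and> abelian_repetition m e w}"

text \<open>For a Sturmian word of irrational angle both sets are finite and nonempty when \<open>m \<ge> 1\<close>
  (shown below), so the maxima are genuine.\<close>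

definition max_power_exponent :: "(nat \<Rightarrow> letter) \<Rightarrow> nat \<Rightarrow> nat" where
  "max_power_exponent s m = Max (power_exponents s m)"

definition max_repetition_exponent :: "(nat \<Rightarrow> letter) \<Rightarrow> nat \<Rightarrow> real" where
  "max_repetition_exponent s m = Max (repetition_exponents s m)"

text \<open>The variant with abelian repetitions in place of abelian powers is shown to be equal in
  \<open>abelian_critical_exponent_repetition\<close>.\<close>

definition abelian_critical_exponent :: "(nat \<Rightarrow> letter) \<Rightarrow> ereal" where
  "abelian_critical_exponent s =
     limsup (\<lambda>m. ereal (real (max_power_exponent s m) / real m))"

definition prefix_count :: "(nat \<Rightarrow> letter) \<Rightarrow> nat \<Rightarrow> int" where
  "prefix_count s n = int (count_list (map s [0..<n]) La)"

lemma prefix_count_Suc: "prefix_count s (Suc n) = prefix_count s n + of_bool (s n = La)"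
  by (simp add: prefix_count_def)

lemma count_factor: "int (count_list (map s [i..<i + n]) La) = prefix_count s (i + n) - prefix_count s i"
  unfolding prefix_count_def using upt_add_eq_append[of 0 i n] by simp

lemma count_La_Lb: "count_list w La + count_list w Lb = length w"
proof (induction w)
  case (Cons x w) then show ?case by (cases x) auto
qed simp

lemma parikh_norm_parikh [simp]: "parikh_norm (parikh w) = length w"
  by (simp add: parikh_norm_def parikh_def count_La_Lb)

lemma parikh_eq_iff: "length u = length v \<Longrightarrow> parikh u = parikh v \<longleftrightarrow> count_list u La = count_list v La"
  using count_La_Lb[of u] count_La_Lb[of v] by (auto simp: parikh_def)

lemma floor_step:
  fixes x \<alpha> :: real assumes "0 < \<alpha>" "\<alpha> < 1"
  shows "\<lfloor>x + \<alpha>\<rfloor> = \<lfloor>x\<rfloor> + of_bool (frac x \<notin> {0..<1 - \<alpha>})"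
  using assms frac_ge_0[of x] frac_lt_1[of x]
  by (cases "frac x < 1 - \<alpha>") (auto simp: frac_def floor_eq_iff, linarith+)

lemma ceiling_step:
  fixes x \<alpha> :: real assumes "0 < \<alpha>" "\<alpha> < 1"
  shows "\<lceil>x + \<alpha>\<rceil> = \<lceil>x\<rceil> + of_bool (frac x \<notin> {0<..1 - \<alpha>})"
proof (cases "frac x = 0")
  case True
  then have "x = of_int \<lfloor>x\<rfloor>" by (simp add: frac_def)
  then obtain z where z: "x = of_int z" by blast
  have "\<lceil>of_int z + \<alpha>\<rceil> = z + 1" using assms by (intro ceiling_unique) auto
  then show ?thesis using z by simp
next
  case False
  then have c: "\<lceil>x\<rceil> = \<lfloor>x\<rfloor> + 1" 
    by (metis ceiling_altdef frac_eq_0_iff Ints_of_int)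
  have "frac x > 0" using False frac_ge_0[of x] by linarith
  then show ?thesis
    using assms frac_lt_1[of x] unfolding c
    by (cases "frac x \<le> 1 - \<alpha>") (auto simp: frac_def ceiling_eq_iff)
qed

lemma prefix_count_bounds:
  assumes "0 < \<alpha>" "\<alpha> < 1" "is_sturmian \<alpha> s"
  obtains \<beta> where "\<And>n. \<beta> + real n * \<alpha> \<le> prefix_count s n" "\<And>n. prefix_count s n \<le> \<beta> + real n * \<alpha> + 1"
proof -
  obtain \<rho> where "s = sturmian_lower \<alpha> \<rho> \<or> s = sturmian_upper \<alpha> \<rho>"
    using assms by (auto simp: is_sturmian_def)
  then show ?thesis
  proof
    assume s: "s = sturmian_lower \<alpha> \<rho>"
    have "prefix_count s n = \<lfloor>\<rho> + real n * \<alpha>\<rfloor> - \<lfloor>\<rho>\<rfloor>" for n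
    proof (induction n)
      case (Suc n)
      show ?case using Suc floor_step[OF assms(1,2), of "\<rho> + real n * \<alpha>"]
        by (simp add: prefix_count_Suc s sturmian_lower_def algebra_simps)
    qed (simp add: prefix_count_def)
    then have "\<rho> - \<lfloor>\<rho>\<rfloor> - 1 + real n * \<alpha> \<le> prefix_count s n \<and>
               prefix_count s n \<le> \<rho> - \<lfloor>\<rho>\<rfloor> - 1 + real n * \<alpha> + 1" for n
      by simp linarith
    then show ?thesis using that by blast
  next
    assume s: "s = sturmian_upper \<alpha> \<rho>"
    have "prefix_count s n = \<lceil>\<rho> + real n * \<alpha>\<rceil> - \<lceil>\<rho>\<rceil>" for n
    proof (induction n)
      case (Suc n)
      show ?case using Suc ceiling_step[OF assms(1,2), of "\<rho> + real n * \<alpha>"]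
        by (simp add: prefix_count_Suc s sturmian_upper_def algebra_simps)
    qed (simp add: prefix_count_def)
    then have "\<rho> - \<lceil>\<rho>\<rceil> + real n * \<alpha> \<le> prefix_count s n \<and>
               prefix_count s n \<le> \<rho> - \<lceil>\<rho>\<rceil> + real n * \<alpha> + 1" for n
      by simp linarith
    then show ?thesis using that by blast
  qed
qed

lemma factor_count_bound:
  assumes "0 < \<alpha>" "\<alpha> < 1" "is_sturmian \<alpha> s"
  shows "\<bar>real_of_int (prefix_count s (i + n) - prefix_count s i) - real n * \<alpha>\<bar> \<le> 1"
proof -
  obtain \<beta> where b: "\<And>n. \<beta> + real n * \<alpha> \<le> prefix_count s n" "\<And>n. prefix_count s n \<le> \<beta> + real n * \<alpha> + 1"
    using prefix_count_bounds[OF assms] by metis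
  show ?thesis using b[of i] b[of "i + n"] by (simp add: algebra_simps abs_le_iff)
qed

lemma irrational_mult_nat:
  assumes "\<alpha> \<notin> \<rat>" "m \<ge> 1" shows "real m * \<alpha> \<noteq> of_int f"
proof
  assume "real m * \<alpha> = of_int f"
  then have "\<alpha> = of_int f / real m" using assms(2) by (simp add: field_simps)
  then show False using assms(1) by (metis Rats_divide Rats_of_int Rats_of_nat)
qed

lemma count_concat_const:
  "\<forall>u\<in>set us. length u = m \<and> parikh u = P \<Longrightarrow>
    length (concat us) = length us * m \<and> count_list (concat us) La = length us * fst P"
  by (induction us) (auto simp: parikh_def)

lemma power_exponent_bound:
  assumes "0 < \<alpha>" "\<alpha> < 1" "\<alpha> \<notin> \<rat>" "is_sturmian \<alpha> s" "m \<ge> 1"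
  obtains B :: nat where "\<And>k. k \<in> power_exponents s m \<Longrightarrow> k \<le> B"
proof -
  define d where "d = \<bar>real m * \<alpha> - of_int (round (real m * \<alpha>))\<bar>"
  have d: "d > 0" unfolding d_def using irrational_mult_nat[OF assms(3,5)] by simp
  have "real k \<le> 1 / d" if k: "k \<in> power_exponents s m" for k
  proof -
    obtain w where kw: "is_factor w s" "abelian_power m k w"
      using k unfolding power_exponents_def by blast
    obtain us P where us: "w = concat us" "length us = k"
      "\<forall>u\<in>set us. length u = m \<and> parikh u = P"
      using kw(2) unfolding abelian_power_def by blast
    obtain i where i: "w = map s [i..<i + length w]"
      using kw(1) unfolding is_factor_def by blast
    note w = i us
    have c: "length w = k * m" "count_list w La = k * fst P"
      using count_concat_const[of us m P] w by auto
    have "int (k * fst P) = prefix_count s (i + k * m) - prefix_count s i"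
      using count_factor[of s i "k * m"] w(1) c by metis
    then have "\<bar>real_of_int (int (k * fst P)) - real (k * m) * \<alpha>\<bar> \<le> 1"
      using factor_count_bound[OF assms(1,2,4), of i "k * m"] by metis
    then have 1: "\<bar>real k * (real m * \<alpha> - of_int (int (fst P)))\<bar> \<le> 1"
      by (simp add: algebra_simps abs_minus_commute)
    have "d \<le> \<bar>real m * \<alpha> - of_int (int (fst P))\<bar>" unfolding d_def by (rule round_diff_minimal)
    then have "real k * d \<le> real k * \<bar>real m * \<alpha> - of_int (int (fst P))\<bar>"
      by (rule mult_left_mono) simp
    also have "\<dots> \<le> 1" using 1 by (simp only: abs_mult abs_of_nat)
    finally have "real k * d \<le> 1" .
    then show ?thesis using d by (simp add: field_simps)
  qed
  then have "k \<le> nat \<lceil>1 / d\<rceil>" if "k \<in> power_exponents s m" for k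
    using that real_nat_ceiling_ge[of "1 / d"] by (meson of_nat_le_iff order_trans)
  then show ?thesis using that by blast
qed

lemma is_factor_append:
  assumes "is_factor (u @ w @ v) s" shows "is_factor w s"
proof -
  obtain i where i: "u @ w @ v = map s [i..<i + (length u + length w + length v)]"
    using assms by (auto simp: is_factor_def add.assoc)
  then have "take (length w) (drop (length u) (u @ w @ v)) = map s [i + length u..<i + length u + length w]"
    unfolding i by (simp add: take_map drop_map)
  then show ?thesis unfolding is_factor_def by (metis append_eq_conv_conj)
qed

text \<open>If no two adjacent blocks of length \<open>m\<close> had the same number of occurrences of \<open>La\<close>,
  these numbers would alternate between two values and force \<open>\<alpha>\<close> to be rational.\<close>

lemma abelian_square_exists:
  assumes "0 < \<alpha>" "\<alpha> < 1" "\<alpha> \<notin> \<rat>" "is_sturmian \<alpha> s" "m \<ge> 1"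
  shows "2 \<in> power_exponents s m"
proof -
  define G where "G i = prefix_count s (i + m) - prefix_count s i" for i
  define f where "f = \<lfloor>real m * \<alpha>\<rfloor>"
  have G: "G i = f \<or> G i = f + 1" for i
  proof -
    have "\<bar>real_of_int (G i) - real m * \<alpha>\<bar> \<le> 1"
      using factor_count_bound[OF assms(1,2,4), of i m] by (simp add: G_def)
    moreover have "real m * \<alpha> \<noteq> of_int f" by (rule irrational_mult_nat[OF assms(3,5)])
    ultimately show ?thesis unfolding f_def by linarith
  qed
  have "\<exists>i. G i = G (i + m)"
  proof (rule ccontr)
    assume "\<not> ?thesis"
    then have GG: "G i + G (i + m) = 2 * f + 1" for i
      using G[of i] G[of "i + m"] by (smt (verit))
    have step: "prefix_count s (i + 2 * m) = prefix_count s i + (2 * f + 1)" for i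
    proof -
      have "G i + G (i + m) = prefix_count s (i + m + m) - prefix_count s i"
        unfolding G_def by simp
      then have "prefix_count s (i + m + m) = prefix_count s i + (2 * f + 1)"
        using GG[of i] by linarith
      then show ?thesis by (simp only: mult_2 add.assoc)
    qed
    have P: "prefix_count s (k * (2 * m)) = int k * (2 * f + 1)" for k
    proof (induction k)
      case (Suc k)
      show ?case using step[of "k * (2 * m)"] Suc by (simp add: algebra_simps)
    qed (simp add: prefix_count_def)
    define e where "e = \<bar>real_of_int (2 * f + 1) - real (2 * m) * \<alpha>\<bar>"
    have "real k * e \<le> 1" for k
    proof -
      have "real k * e = \<bar>real_of_int (int k * (2 * f + 1)) - real (k * (2 * m)) * \<alpha>\<bar>"
        unfolding e_def by (subst abs_of_nat[symmetric], subst abs_mult[symmetric]) (simp add: algebra_simps)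
      then show ?thesis
        using factor_count_bound[OF assms(1,2,4), of 0 "k * (2 * m)"] P[of k] prefix_count_def[of s 0]
        by simp
    qed
    moreover have "e > 0" 
      using irrational_mult_nat[OF assms(3), of "2 * m" "2 * f + 1"] assms(5) by (simp add: e_def)
    ultimately show False by (metis not_less reals_Archimedean3)
  qed
  then obtain i where i: "G i = G (i + m)" by blast
  let ?u = "map s [i..<i + m]" and ?v = "map s [i + m..<i + m + m]"
  have "count_list ?u La = count_list ?v La"
    using count_factor[of s i m] count_factor[of s "i + m" m] i unfolding G_def by linarith
  then have "parikh ?u = parikh ?v" by (simp add: parikh_eq_iff)
  then have "abelian_power m 2 (?u @ ?v)"
    unfolding abelian_power_def by (intro exI[of _ "[?u, ?v]"]) auto
  moreover have "is_factor (?u @ ?v) s"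
    unfolding is_factor_def using upt_add_eq_append[of i "i + m" m] by (intro exI[of _ i]) (simp add: add.assoc)
  ultimately show ?thesis by (auto simp: power_exponents_def)
qed

lemma finite_power_exponents:
  assumes "0 < \<alpha>" "\<alpha> < 1" "\<alpha> \<notin> \<rat>" "is_sturmian \<alpha> s" "m \<ge> 1"
  shows "finite (power_exponents s m)"
  using power_exponent_bound[OF assms] by (metis finite_nat_set_iff_bounded_le)

lemma power_is_repetition:
  assumes "k \<in> power_exponents s m" "k \<ge> 2" "m \<ge> 1"
  shows "real k \<in> repetition_exponents s m"
proof -
  obtain w us P where w: "is_factor w s" "w = concat us" "length us = k"
      "\<forall>u\<in>set us. length u = m \<and> parikh u = P"
    using assms(1) unfolding power_exponents_def abelian_power_def by blast
  have "length w = k * m"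
    using count_concat_const[of us m P] w by auto
  moreover have "parikh_contained (parikh []) P"
  proof -
    obtain u where "u \<in> set us" using w(3) assms(2) by (cases us) auto
    then have "parikh_norm P = m" using w(4) parikh_norm_parikh by metis
    then show ?thesis using assms(3) by (simp add: parikh_contained_def) (simp add: parikh_def)
  qed
  ultimately have "abelian_repetition m (real k) w"
    unfolding abelian_repetition_def using w assms(2,3)
    by (intro conjI exI[of _ "[]"] exI[of _ us] exI[of _ P]) auto
  then show ?thesis using w(1) by (auto simp: repetition_exponents_def)
qed

lemma repetition_exponent_bound:
  assumes "e \<in> repetition_exponents s m" "m \<ge> 1"
  obtains k l where "k \<in> power_exponents s m" "e = real l / real m" "e < real k + 2"
proof -
  obtain w u us v P where w: "is_factor w s" "e = real (length w) / real m" "w = u @ concat us @ v"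
     "length us \<ge> 2" "\<forall>x\<in>set us. length x = m \<and> parikh x = P"
     "parikh_contained (parikh u) P" "parikh_contained (parikh v) P"
    using assms(1) unfolding repetition_exponents_def abelian_repetition_def by blast
  obtain x where "x \<in> set us" using w(4) by (cases us) auto
  then have "parikh_norm P = m" using w(5) parikh_norm_parikh by metis
  then have uv: "length u < m" "length v < m" using w(6,7) by (auto simp: parikh_contained_def)
  have "length (concat us) = length us * m"
    using count_concat_const[of us m P] w(5) by auto
  then have "length w < (length us + 2) * m" using uv w(3) by simp
  then have "real (length w) < (real (length us) + 2) * real m"
    by (metis of_nat_add of_nat_less_iff of_nat_mult of_nat_numeral)
  then have "e < real (length us) + 2" using w(2) assms(2) by (simp add: pos_divide_less_eq)
  moreover have "is_factor (concat us) s" using w(1,3) is_factor_append by blast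
  then have "length us \<in> power_exponents s m"
    using w(4,5) unfolding power_exponents_def abelian_power_def by fastforce
  ultimately show ?thesis using that w(2) by blast
qed

lemma finite_repetition_exponents:
  assumes "0 < \<alpha>" "\<alpha> < 1" "\<alpha> \<notin> \<rat>" "is_sturmian \<alpha> s" "m \<ge> 1"
  shows "finite (repetition_exponents s m)"
proof -
  obtain B where B: "\<And>k. k \<in> power_exponents s m \<Longrightarrow> k \<le> B"
    using power_exponent_bound[OF assms] by metis
  have "repetition_exponents s m \<subseteq> (\<lambda>l. real l / real m) ` {..(B + 2) * m}"
  proof
    fix e assume "e \<in> repetition_exponents s m"
    then obtain k l where k: "k \<in> power_exponents s m" "e = real l / real m" "e < real k + 2"
      using repetition_exponent_bound assms(5) by metis
    have "real l / real m \<le> real (B + 2)" using k B[of k] by simp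
    then have "real l \<le> real ((B + 2) * m)" using assms(5) by (simp add: field_simps)
    then have "l \<le> (B + 2) * m" by (simp only: of_nat_le_iff)
    then show "e \<in> (\<lambda>l. real l / real m) ` {..(B + 2) * m}" using k by auto
  qed
  then show ?thesis by (rule finite_subset) simp
qed

lemma max_exponent_compare:
  assumes "0 < \<alpha>" "\<alpha> < 1" "\<alpha> \<notin> \<rat>" "is_sturmian \<alpha> s" "m \<ge> 1"
  shows "real (max_power_exponent s m) \<le> max_repetition_exponent s m"
    and "max_repetition_exponent s m < real (max_power_exponent s m) + 2"
proof -
  note fin = finite_power_exponents[OF assms] finite_repetition_exponents[OF assms]
  have two: "2 \<in> power_exponents s m" by (rule abelian_square_exists[OF assms])
  have "max_power_exponent s m \<in> power_exponents s m" "max_power_exponent s m \<ge> 2"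
    unfolding max_power_exponent_def using fin two by (auto intro: Max_in Max_ge)
  then have in_rep: "real (max_power_exponent s m) \<in> repetition_exponents s m"
    using power_is_repetition assms(5) by blast
  then show "real (max_power_exponent s m) \<le> max_repetition_exponent s m"
    unfolding max_repetition_exponent_def using fin by (intro Max_ge)
  have "max_repetition_exponent s m \<in> repetition_exponents s m"
    unfolding max_repetition_exponent_def using fin in_rep by (intro Max_in) auto
  then obtain k where k: "k \<in> power_exponents s m" "max_repetition_exponent s m < real k + 2"
    using repetition_exponent_bound assms(5) by metis
  then have "k \<le> max_power_exponent s m"
    unfolding max_power_exponent_def using fin by (intro Max_ge)
  then show "max_repetition_exponent s m < real (max_power_exponent s m) + 2" using k by linarith
qed

theorem abelian_critical_exponent_repetition:
  assumes "0 < \<alpha>" "\<alpha> < 1" "\<alpha> \<notin> \<rat>" "is_sturmian \<alpha> s"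
  shows "abelian_critical_exponent s =
    limsup (\<lambda>m. ereal (max_repetition_exponent s m / real m))"
proof (rule antisym)
  show "abelian_critical_exponent s \<le> limsup (\<lambda>m. ereal (max_repetition_exponent s m / real m))"
    unfolding abelian_critical_exponent_def
  proof (rule Limsup_mono, rule eventually_mono[OF eventually_ge_at_top[of 1]])
    fix m :: nat assume "m \<ge> 1"
    then show "ereal (real (max_power_exponent s m) / real m) \<le> ereal (max_repetition_exponent s m / real m)"
      using max_exponent_compare(1)[OF assms] by (simp add: divide_right_mono)
  qed
next
  have "limsup (\<lambda>m. ereal (max_repetition_exponent s m / real m)) \<le>
        limsup (\<lambda>m. ereal (2 / real m) + ereal (real (max_power_exponent s m) / real m))"
  proof (rule Limsup_mono, rule eventually_mono[OF eventually_ge_at_top[of 1]])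
    fix m :: nat assume m: "m \<ge> 1"
    have "max_repetition_exponent s m / real m \<le> (2 + real (max_power_exponent s m)) / real m"
      using max_exponent_compare(2)[OF assms m] by (intro divide_right_mono) auto
    then show "ereal (max_repetition_exponent s m / real m)
      \<le> ereal (2 / real m) + ereal (real (max_power_exponent s m) / real m)"
      by (simp add: add_divide_distrib)
  qed
  also have "\<dots> = 0 + limsup (\<lambda>m. ereal (real (max_power_exponent s m) / real m))"
  proof (rule ereal_limsup_lim_add)
    have "(\<lambda>m. 2 / real m) \<longlonglongrightarrow> 0" by (rule lim_const_over_n)
    then show "(\<lambda>m. ereal (2 / real m)) \<longlonglongrightarrow> 0" by (simp add: zero_ereal_def)
  qed simp
  finally show "limsup (\<lambda>m. ereal (max_repetition_exponent s m / real m)) \<le> abelian_critical_exponent s"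
    by (simp add: abelian_critical_exponent_def)
qed

end

theory Submission
  imports Defs
begin

text \<open>With \<open>\<parallel>x\<parallel>\<close> the distance to the nearest integer, the prefix counts of a Sturmian word
  stay in a strip of width 1 of slope \<open>\<alpha>\<close>, so an abelian power of period \<open>m\<close> and exponent \<open>k\<close>
  drifts by \<open>k\<parallel>m\<alpha>\<parallel>\<close> inside that strip; by density of the rotation the maximal \<open>k\<close> is
  \<open>1/\<parallel>m\<alpha>\<parallel>\<close> up to an error of 1. Hence the critical exponent is the upper limit of
  \<open>1/(m\<parallel>m\<alpha>\<parallel>)\<close>, which by the law of best approximation is attained along the denominators
  \<open>q\<^sub>i\<close> of the convergents, where \<open>1/(q\<^sub>i\<parallel>q\<^sub>i\<alpha>\<parallel>)\<close> is \<open>\<alpha>\<^sub>i\<^sub>+\<^sub>1 + q\<^sub>i\<^sub>-\<^sub>1/q\<^sub>i\<close> for the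
  complete quotients \<open>\<alpha>\<^sub>i\<close>.\<close>

section \<open>Infinite continued fractions\<close>

lemma cfrac_fin_Cons: "xs \<noteq> [] \<Longrightarrow> cfrac_fin (x # xs) = of_int x + 1 / cfrac_fin xs"
  by (cases xs) auto

definition cfrac_conv :: "(nat \<Rightarrow> int) \<Rightarrow> nat \<Rightarrow> real" where
  "cfrac_conv a n = cfrac_fin (map a [0..<Suc n])"

lemma cfrac_conv_0: "cfrac_conv a 0 = of_int (a 0)"
  by (simp add: cfrac_conv_def)

lemma cfrac_conv_Suc: "cfrac_conv a (Suc n) = of_int (a 0) + 1 / cfrac_conv (\<lambda>k. a (Suc k)) n"
proof -
  have "map a [0..<Suc (Suc n)] = a 0 # map (\<lambda>k. a (Suc k)) [0..<Suc n]"
    by (subst upt_conv_Cons) (simp_all only: map_Suc_upt[symmetric] list.map map_map o_def zero_less_Suc)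
  then show ?thesis
    unfolding cfrac_conv_def by (simp only:) (rule cfrac_fin_Cons, simp)
qed

lemma cfrac_conv_bounds:
  assumes "\<And>i. a i \<ge> 1"
  shows "1 \<le> cfrac_conv a n" "of_int (a 0) \<le> cfrac_conv a n" "cfrac_conv a n \<le> of_int (a 0) + 1"
proof -
  have "(\<And>i. a i \<ge> 1) \<Longrightarrow> 1 \<le> cfrac_conv a n \<and> of_int (a 0) \<le> cfrac_conv a n
      \<and> cfrac_conv a n \<le> of_int (a 0) + 1" for a
  proof (induction n arbitrary: a)
    case 0 
    then show ?case by (simp add: cfrac_conv_0)
  next
    case (Suc n)
    have "1 \<le> cfrac_conv (\<lambda>k. a (Suc k)) n" using Suc.IH[of "\<lambda>k. a (Suc k)"] Suc.prems by blast
    then have "0 \<le> 1 / cfrac_conv (\<lambda>k. a (Suc k)) n" "1 / cfrac_conv (\<lambda>k. a (Suc k)) n \<le> 1" by auto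
    moreover have "1 \<le> real_of_int (a 0)" using Suc.prems[of 0] by simp
    ultimately show ?case unfolding cfrac_conv_Suc by linarith
  qed
  then show "1 \<le> cfrac_conv a n" "of_int (a 0) \<le> cfrac_conv a n" "cfrac_conv a n \<le> of_int (a 0) + 1"
    using assms by blast+
qed

text \<open>A single step \<open>b + 1 / u\<close> has slope of modulus 1 at \<open>u = 1\<close>;
  two steps form a Moebius map of determinant 1, and both denominators \<open>b1 * u + 1\<close>,
  \<open>b1 * v + 1\<close> are at least 2.\<close>

lemma two_step_contraction:
  fixes b0 b1 u v :: real
  assumes "b1 \<ge> 1" "u \<ge> 1" "v \<ge> 1"
  shows "\<bar>(b0 + 1 / (b1 + 1 / u)) - (b0 + 1 / (b1 + 1 / v))\<bar> \<le> \<bar>u - v\<bar> / 4"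
proof -
  have p: "b1 * u \<ge> 1" "b1 * v \<ge> 1" using assms mult_mono[of 1 b1 1 u] mult_mono[of 1 b1 1 v] by auto
  have r: "1 / (b1 + 1 / x) = x / (b1 * x + 1)" if "x \<ge> 1" for x
    using that by (simp add: field_simps)
  have "u / (b1 * u + 1) - v / (b1 * v + 1) = (u - v) / ((b1 * u + 1) * (b1 * v + 1))"
    using p by (simp add: divide_simps) (simp add: algebra_simps)
  then have "\<bar>(b0 + 1 / (b1 + 1 / u)) - (b0 + 1 / (b1 + 1 / v))\<bar> = \<bar>u - v\<bar> / ((b1 * u + 1) * (b1 * v + 1))"
    using p r assms by (simp add: abs_mult)
  also have "\<dots> \<le> \<bar>u - v\<bar> / 4"
    using mult_mono[of 2 "b1 * u + 1" 2 "b1 * v + 1"] p by (intro divide_left_mono) auto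
  finally show ?thesis .
qed

text \<open>Both convergents share their first \<open>2 * N\<close> partial quotients. Peeling these
  off in pairs gains a factor 1/4 each time and leaves two values in one interval of length
  1.\<close>

lemma cfrac_conv_contraction:
  assumes "\<And>i. a i \<ge> 1"
  shows "\<bar>cfrac_conv a (2 * N + n) - cfrac_conv a (2 * N + m)\<bar> \<le> (1 / 4) ^ N"
  using assms
proof (induction N arbitrary: a)
  case 0
  then show ?case
    using cfrac_conv_bounds(2,3)[of a n] cfrac_conv_bounds(2,3)[of a m] by (simp add: abs_le_iff)
next
  case (Suc N)
  let ?a = "\<lambda>k. a (Suc (Suc k))"
  have e: "cfrac_conv a (2 * Suc N + k)
      = of_int (a 0) + 1 / (of_int (a 1) + 1 / cfrac_conv ?a (2 * N + k))" for k
    by (simp add: cfrac_conv_Suc)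
  have "\<bar>cfrac_conv a (2 * Suc N + n) - cfrac_conv a (2 * Suc N + m)\<bar>
      \<le> \<bar>cfrac_conv ?a (2 * N + n) - cfrac_conv ?a (2 * N + m)\<bar> / 4"
    unfolding e using Suc.prems by (intro two_step_contraction cfrac_conv_bounds) auto
  also have "\<dots> \<le> (1 / 4) ^ N / 4"
    using Suc.IH[of ?a] Suc.prems by (intro divide_right_mono) auto
  finally show ?case by simp
qed

lemma cfrac_conv_convergent:
  assumes "\<And>i. a i \<ge> 1"
  shows "convergent (cfrac_conv a)"
proof -
  have "Cauchy (cfrac_conv a)"
  proof (rule CauchyI)
    fix e :: real assume "0 < e"
    then obtain N where N: "(1 / 4) ^ N < e" using real_arch_pow_inv[of e "1/4"] by auto
    have "norm (cfrac_conv a m - cfrac_conv a n) < e" if "2 * N \<le> m" "2 * N \<le> n" for m n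
    proof -
      obtain m' n' where "m = 2 * N + m'" "n = 2 * N + n'" using \<open>2 * N \<le> m\<close> \<open>2 * N \<le> n\<close> le_Suc_ex by metis
      then show ?thesis using cfrac_conv_contraction[of a N m' n'] assms N by auto
    qed
    then show "\<exists>M. \<forall>m\<ge>M. \<forall>n\<ge>M. norm (cfrac_conv a m - cfrac_conv a n) < e" by blast
  qed
  then show ?thesis by (simp add: Cauchy_convergent_iff)
qed

lemma cfrac_inf_eq_lim: "cfrac_inf a = lim (cfrac_conv a)"
  by (simp add: cfrac_inf_def cfrac_conv_def[abs_def])

lemma cfrac_inf_ge_1:
  assumes "\<And>i. a i \<ge> 1"
  shows "cfrac_inf a \<ge> 1"
proof (rule LIMSEQ_le_const)
  show "cfrac_conv a \<longlonglongrightarrow> cfrac_inf a"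
    unfolding cfrac_inf_eq_lim using cfrac_conv_convergent assms convergent_LIMSEQ_iff by blast
  show "\<exists>N. \<forall>n\<ge>N. 1 \<le> cfrac_conv a n" using cfrac_conv_bounds(1) assms by blast
qed

text \<open>The assumption starts at index 1 because \<open>a 0\<close> is 0 for an angle in (0,
  1).\<close>

lemma cfrac_inf_unfold:
  assumes "\<And>i. a (Suc i) \<ge> 1"
  shows "cfrac_inf a = of_int (a 0) + 1 / cfrac_inf (\<lambda>k. a (Suc k))"
proof -
  let ?b = "\<lambda>k. a (Suc k)"
  have "cfrac_conv ?b \<longlonglongrightarrow> cfrac_inf ?b"
    unfolding cfrac_inf_eq_lim using cfrac_conv_convergent[of ?b] assms convergent_LIMSEQ_iff by blast
  moreover have "cfrac_inf ?b \<noteq> 0" using cfrac_inf_ge_1[of ?b] assms by force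
  ultimately have "(\<lambda>n. of_int (a 0) + 1 / cfrac_conv ?b n) \<longlonglongrightarrow> of_int (a 0) + 1 / cfrac_inf ?b"
    by (intro tendsto_intros) auto
  then have "(\<lambda>n. cfrac_conv a (Suc n)) \<longlonglongrightarrow> of_int (a 0) + 1 / cfrac_inf ?b"
    by (simp only: cfrac_conv_Suc)
  then have "cfrac_conv a \<longlonglongrightarrow> of_int (a 0) + 1 / cfrac_inf ?b"
    by (rule LIMSEQ_imp_Suc)
  then show ?thesis unfolding cfrac_inf_eq_lim[of a] by (rule limI)
qed

section \<open>Convergents and best approximation\<close>

text \<open>Indices are shifted by one: \<open>cfrac_num a n\<close> and \<open>cfrac_den a n\<close> are the classical
  \<open>p\<^sub>n\<^sub>-\<^sub>1\<close> and \<open>q\<^sub>n\<^sub>-\<^sub>1\<close>, starting with \<open>p\<^sub>-\<^sub>1 = 1\<close> and \<open>q\<^sub>-\<^sub>1 = 0\<close>.\<close>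

fun cfrac_num :: "(nat \<Rightarrow> int) \<Rightarrow> nat \<Rightarrow> int" where
  "cfrac_num a 0 = 1"
| "cfrac_num a (Suc 0) = a 0"
| "cfrac_num a (Suc (Suc n)) = a (Suc n) * cfrac_num a (Suc n) + cfrac_num a n"

fun cfrac_den :: "(nat \<Rightarrow> int) \<Rightarrow> nat \<Rightarrow> int" where
  "cfrac_den a 0 = 0"
| "cfrac_den a (Suc 0) = 1"
| "cfrac_den a (Suc (Suc n)) = a (Suc n) * cfrac_den a (Suc n) + cfrac_den a n"

lemma cfrac_det:
  "cfrac_num a (Suc n) * cfrac_den a n - cfrac_num a n * cfrac_den a (Suc n) = (- 1) ^ (n + 1)"
  by (induction n) (auto simp: algebra_simps)

locale pos_cfrac =
  fixes a :: "nat \<Rightarrow> int"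
  assumes pos: "i \<ge> 1 \<Longrightarrow> a i \<ge> 1"
begin

definition quot :: "nat \<Rightarrow> real" where "quot i = cfrac_inf (\<lambda>n. a (i + n))"

lemma quot_unfold: "quot i = of_int (a i) + 1 / quot (Suc i)"
  unfolding quot_def using cfrac_inf_unfold[of "\<lambda>n. a (i + n)"] pos by simp

lemma quot_ge_1: "quot (Suc i) \<ge> 1"
  unfolding quot_def using pos by (intro cfrac_inf_ge_1) auto

lemma den_pos: "cfrac_den a (Suc n) \<ge> 1 \<and> cfrac_den a n \<ge> 0"
proof (induction n)
  case (Suc n)
  have "1 * 1 \<le> a (Suc n) * cfrac_den a (Suc n)" using Suc pos[of "Suc n"] by (intro mult_mono) auto
  then show ?case using Suc by simp
qed simp

lemma den_step: "cfrac_den a (Suc (Suc n)) \<ge> cfrac_den a (Suc n) + cfrac_den a n"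
  using mult_right_mono[of 1 "a (Suc n)" "cfrac_den a (Suc n)"] pos[of "Suc n"] den_pos[of n] by simp

lemma den_mono: "m \<le> n \<Longrightarrow> cfrac_den a m \<le> cfrac_den a n"
proof (induction rule: dec_induct)
  case (step n)
  then show ?case using den_step[of "n - 1"] den_pos[of "n - 1"] by (cases n) (auto simp del: cfrac_den.simps(3))
qed simp

lemma den_ge: "cfrac_den a (Suc n) \<ge> int n"
proof (induction n)
  case (Suc n)
  show ?case
  proof (cases n)
    case 0
    then show ?thesis using den_pos[of 1] by simp
  next
    case (Suc k)
    then show ?thesis using \<open>cfrac_den a (Suc n) \<ge> int n\<close> den_step[of n] den_pos[of k] by (simp del: cfrac_den.simps(3))
  qed
qed simp

text \<open>Kept signed, since the alternation of signs is what best approximation rests on;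
  \<open>err 0\<close> is -1.\<close>

definition err :: "nat \<Rightarrow> real" where "err n = cfrac_den a n * cfrac_inf a - cfrac_num a n"

text \<open>The errors obey the recurrence of the convergents; eliminating \<open>err n\<close> by
  induction leaves the factor \<open>a (Suc n) - quot (Suc n)\<close>, which is
  \<open>- 1 / quot (Suc (Suc n))\<close>.\<close>

lemma err_Suc: "err (Suc n) = - err n / quot (Suc n)"
proof (induction n)
  case 0
  show ?case using quot_unfold[of 0] by (simp add: err_def quot_def[of 0])
next
  case (Suc n)
  have q: "quot (Suc n) > 0" using quot_ge_1[of n] by linarith
  have "err (Suc (Suc n)) = a (Suc n) * err (Suc n) + err n"
    by (simp add: err_def algebra_simps)
  also have "err n = - quot (Suc n) * err (Suc n)" using Suc q by (simp add: field_simps)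
  also have "a (Suc n) * err (Suc n) + \<dots> = - err (Suc n) / quot (Suc (Suc n))"
    by (subst quot_unfold) (simp add: algebra_simps)
  finally show ?case .
qed

text \<open>By \<open>err_Suc\<close> and \<open>quot_unfold\<close> the product only changes sign
  from \<open>n\<close> to \<open>Suc n\<close>.\<close>

lemma err_formula: "(cfrac_den a (Suc n) * quot (Suc n) + cfrac_den a n) * err (Suc n) = (- 1) ^ n"
proof (induction n)
  case 0
  show ?case using err_Suc[of 0] quot_ge_1[of 0] by (simp add: err_def[of 0])
next
  case (Suc n)
  have q: "quot (Suc (Suc n)) > 0" using quot_ge_1[of "Suc n"] by linarith
  have "(cfrac_den a (Suc (Suc n)) * quot (Suc (Suc n)) + cfrac_den a (Suc n)) * err (Suc (Suc n))
      = - (cfrac_den a (Suc (Suc n)) + cfrac_den a (Suc n) * (1 / quot (Suc (Suc n)))) * err (Suc n)"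
    unfolding err_Suc[of "Suc n"] using q by (simp add: field_simps)
  also have "\<dots> = - ((cfrac_den a (Suc n) * quot (Suc n) + cfrac_den a n) * err (Suc n))"
    by (subst quot_unfold[of "Suc n"]) (simp add: algebra_simps)
  finally show ?case using Suc by simp
qed

lemma err_nonzero: "err (Suc n) \<noteq> 0"
  using err_formula[of n] by auto

lemma inverse_den_err:
  "1 / (cfrac_den a (Suc n) * \<bar>err (Suc n)\<bar>) = quot (Suc n) + cfrac_den a n / cfrac_den a (Suc n)"
proof -
  have Q: "real_of_int (cfrac_den a (Suc n)) > 0" "real_of_int (cfrac_den a n) \<ge> 0"
    using den_pos[of n] by auto
  have "\<bar>(cfrac_den a (Suc n) * quot (Suc n) + cfrac_den a n) * err (Suc n)\<bar> = 1"
    unfolding err_formula by simp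
  then have "(cfrac_den a (Suc n) * quot (Suc n) + cfrac_den a n) * \<bar>err (Suc n)\<bar> = 1"
    using Q quot_ge_1[of n] by (simp add: abs_mult)
  then show ?thesis using Q err_nonzero[of n] by (simp add: field_simps)
qed

text \<open>Dividing the recurrence of the denominators by the middle one puts the newest partial
  quotient outermost, hence the reversed list.\<close>

lemma den_ratio: "cfrac_den a n / cfrac_den a (Suc n) = cfrac_fin (0 # map a (rev [1..<n + 1]))"
proof (induction n)
  case (Suc n)
  let ?l = "map a (rev [1..<n + 1])"
  have "cfrac_fin (a (Suc n) # ?l) = a (Suc n) + cfrac_fin (0 # ?l)"
    by (cases ?l) auto
  moreover have "map a (rev [1..<Suc n + 1]) = a (Suc n) # ?l" by simp
  ultimately have "cfrac_fin (0 # map a (rev [1..<Suc n + 1]))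
      = 1 / (a (Suc n) + cfrac_den a n / cfrac_den a (Suc n))"
    using Suc by (simp only: cfrac_fin.simps of_int_0 add_0)
  then show ?case using den_pos[of n] by (simp add: field_simps)
qed simp

text \<open>The determinant identity writes \<open>(m, p)\<close> as an integral combination of two consecutive
  convergents; since \<open>m\<close> is smaller than the second denominator the coefficients have opposite
  signs, and so do the errors, whence no cancellation.\<close>

lemma best_approximation:
  fixes m p :: int
  assumes "1 \<le> m" "m < cfrac_den a (Suc (Suc n))"
  shows "\<bar>err (Suc n)\<bar> \<le> \<bar>m * cfrac_inf a - p\<bar>"
proof -
  define q q' r r' where "q = cfrac_den a (Suc n)" and "q' = cfrac_den a (Suc (Suc n))"
    and "r = cfrac_num a (Suc n)" and "r' = cfrac_num a (Suc (Suc n))"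
  define s :: int where "s = (- 1) ^ (Suc n + 1)"
  \<comment> \<open>Cramer's rule; dividing by the determinant \<open>s\<close> is multiplying by
    it, as \<open>s\<close> is 1 or -1.\<close>
  define x y where "x = s * (m * r' - p * q')" and "y = s * (p * q - m * r)"
  have det: "r' * q - r * q' = s" using cfrac_det[of a "Suc n"] by (simp add: q_def q'_def r_def r'_def s_def)
  have ss: "s * s = 1" by (simp add: s_def flip: power_add)
  have q: "q \<ge> 1" "q' \<ge> 1" using den_pos[of n] den_pos[of "Suc n"] by (auto simp: q_def q'_def simp del: cfrac_den.simps)
  have "x * q + y * q' = s * m * (r' * q - r * q')" by (simp add: x_def y_def algebra_simps)
  then have m: "m = x * q + y * q'" using det ss by (simp add: mult.assoc mult.left_commute)
  have "x * r + y * r' = s * p * (r' * q - r * q')" by (simp add: x_def y_def algebra_simps)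
  then have p: "p = x * r + y * r'" using det ss by (simp add: mult.assoc mult.left_commute)
  have E: "m * cfrac_inf a - p = x * err (Suc n) + y * err (Suc (Suc n))"
    unfolding m p by (simp add: err_def q_def q'_def r_def r'_def algebra_simps)
  \<comment> \<open>The positive ratio of the moduli of consecutive errors, which have opposite
    signs.\<close>
  define t where "t = 1 / quot (Suc (Suc n))"
  have t: "t > 0" using quot_ge_1[of "Suc n"] by (simp add: t_def)
  have E': "m * cfrac_inf a - p = (x - y * t) * err (Suc n)"
    unfolding E err_Suc[of "Suc n"] t_def by (simp add: algebra_simps)
  have mq: "m < q'" using assms by (simp add: q'_def)
  have xy: "x \<ge> 1 \<and> y \<le> 0 \<or> x \<le> - 1 \<and> y \<ge> 0"
  proof -
    have "x \<noteq> 0"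
    proof
      assume "x = 0"
      then have "0 < y * q'" "y * q' < 1 * q'" using m mq assms by auto
      then show False using q by (simp add: zero_less_mult_iff)
    qed
    moreover have "\<not> (x \<ge> 1 \<and> y \<ge> 1)"
    proof
      assume "x \<ge> 1 \<and> y \<ge> 1"
      then have "x * q \<ge> 0" "1 * q' \<le> y * q'" using q by (auto intro!: mult_right_mono)
      then show False using m mq by linarith
    qed
    moreover have "\<not> (x \<le> - 1 \<and> y \<le> - 1)"
    proof
      assume "x \<le> - 1 \<and> y \<le> - 1"
      then have "x * q \<le> 0" "y * q' \<le> 0" using q by (auto simp: mult_le_0_iff)
      then show False using m assms by linarith
    qed
    ultimately show ?thesis by linarith
  qed
  have "1 \<le> \<bar>x - y * t\<bar>"
    using xy
  proof
    assume *: "x \<ge> 1 \<and> y \<le> 0"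
    then have "y * t \<le> 0" "real_of_int x \<ge> 1" using t by (auto simp: mult_le_0_iff)
    then show ?thesis by linarith
  next
    assume *: "x \<le> - 1 \<and> y \<ge> 0"
    then have "y * t \<ge> 0" "real_of_int x \<le> - 1" using t by auto
    then show ?thesis by linarith
  qed
  then have "1 * \<bar>err (Suc n)\<bar> \<le> \<bar>x - y * t\<bar> * \<bar>err (Suc n)\<bar>" by (intro mult_right_mono) auto
  then show ?thesis unfolding E' by (simp add: abs_mult)
qed

lemma den_bracket:
  assumes "m \<ge> 1"
  obtains i where "cfrac_den a (Suc i) \<le> int m" "int m < cfrac_den a (Suc (Suc i))"
proof -
  have "\<exists>n. int m < cfrac_den a (Suc n)" using den_ge[of "Suc m"] by (intro exI[of _ "Suc m"]) simp
  moreover have "\<not> int m < cfrac_den a (Suc 0)" using assms by simp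
  ultimately obtain i where "\<not> int m < cfrac_den a (Suc i)" "int m < cfrac_den a (Suc (Suc i))"
    using ex_least_nat_less[of "\<lambda>n. int m < cfrac_den a (Suc n)"] by (metis lessI less_imp_le_nat order_refl)
  then show ?thesis using that[of i] by linarith
qed

end

section \<open>Exponents of abelian powers\<close>

text \<open>Equal increments of the prefix count at the block boundaries give all blocks the same
  number of \<open>La\<close>, and their common length fixes the rest of the Parikh vector.\<close>

lemma abelian_power_factor:
  assumes "\<And>j. j \<le> k \<Longrightarrow> prefix_count s (i + j * m) = prefix_count s i + int j * p" "k \<ge> 1"
  shows "k \<in> power_exponents s m"
proof -
  define us where "us = map (\<lambda>j. map s [i + j * m..<i + j * m + m]) [0..<k]"
  have c: "concat (map (\<lambda>j. map s [i + j * m..<i + j * m + m]) [0..<n]) = map s [i..<i + n * m]" for n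
  proof (induction n)
    case (Suc n)
    have "i + Suc n * m = i + n * m + m" by simp
    then have "[i..<i + Suc n * m] = [i..<i + n * m] @ [i + n * m..<i + n * m + m]"
      by (simp only:) (rule upt_add_eq_append, simp)
    then show ?case using Suc by (simp del: mult_Suc)
  qed simp
  have u: "length u = m \<and> parikh u = (nat p, m - nat p)" if u: "u \<in> set us" for u
  proof -
    obtain j where j: "j < k" "u = map s [i + j * m..<i + j * m + m]"
      using u by (auto simp: us_def)
    have "int (count_list u La) = prefix_count s (i + Suc j * m) - prefix_count s (i + j * m)"
      using count_factor[of s "i + j * m" m] j by (simp add: ac_simps)
    also have "\<dots> = p" using assms(1)[of j] assms(1)[of "Suc j"] j by (simp add: algebra_simps)
    finally have "count_list u La = nat p" by simp
    moreover have "length u = m" using j by simp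
    ultimately show ?thesis using count_La_Lb[of u] by (auto simp: parikh_def)
  qed
  have "is_factor (concat us) s"
    unfolding is_factor_def by (rule exI[of _ i]) (simp add: us_def c)
  moreover have "abelian_power m k (concat us)"
    unfolding abelian_power_def using u assms(2)
    by (intro exI[of _ us] exI[of _ "(nat p, m - nat p)"]) (auto simp: us_def)
  ultimately show ?thesis by (auto simp: power_exponents_def)
qed

lemma power_exponent_ge:
  fixes p :: int
  assumes "0 < \<alpha>" "\<alpha> < 1" "\<alpha> \<notin> \<rat>" "is_sturmian \<alpha> s" "k \<ge> 1" "real k * \<bar>real m * \<alpha> - p\<bar> < 1"
  shows "k \<in> power_exponents s m"
proof -
  obtain \<beta> where b: "\<And>n. \<beta> + real n * \<alpha> \<le> prefix_count s n" "\<And>n. prefix_count s n \<le> \<beta> + real n * \<alpha> + 1"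
    using prefix_count_bounds[OF assms(1,2,4)] by metis
  define \<delta> where "\<delta> = real m * \<alpha> - p"
  \<comment> \<open>Half the room that the total drift leaves in the unit interval.\<close>
  define \<epsilon> where "\<epsilon> = (1 - real k * \<bar>\<delta>\<bar>) / 2"
  have \<epsilon>: "\<epsilon> > 0" using assms(6) by (simp add: \<epsilon>_def \<delta>_def)
  text \<open>the centre of the admissible starting points, those whose drift by \<open>k\<delta>\<close> stays in \<open>(0, 1)\<close>\<close>
  define x where "x = (1 - real k * \<delta>) / 2"
  obtain h l where hl: "l > 0" "\<bar>of_int l * \<alpha> - of_int h - (x - \<beta>)\<bar> < \<epsilon>"
    using sequence_of_fractional_parts_is_dense[OF assms(3) \<epsilon>, of "x - \<beta>"] by metis
  define i where "i = nat l"
  define y where "y = \<beta> + real i * \<alpha> - of_int h"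
  have y: "\<bar>y - x\<bar> < \<epsilon>" using hl by (simp add: y_def i_def algebra_simps)
  have in01: "0 < y + real j * \<delta> \<and> y + real j * \<delta> < 1" if "j \<le> k" for j
  proof (cases "\<delta> \<ge> 0")
    case True
    then have "2 * \<epsilon> = 1 - real k * \<delta>" "0 \<le> real j * \<delta>" "real j * \<delta> \<le> real k * \<delta>"
      using that by (auto simp: \<epsilon>_def intro!: mult_right_mono)
    moreover have "2 * x = 1 - real k * \<delta>" by (simp add: x_def)
    ultimately show ?thesis using y by linarith
  next
    case False
    then have "2 * \<epsilon> = 1 + real k * \<delta>" "real j * \<delta> \<le> 0" "real k * \<delta> \<le> real j * \<delta>"
      using that by (auto simp: \<epsilon>_def mult_le_0_iff intro!: mult_right_mono_neg)
    moreover have "2 * x = 1 - real k * \<delta>" by (simp add: x_def)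
    ultimately show ?thesis using y by linarith
  qed
  \<comment> \<open>The strip of width 1 around this count has its ends strictly between integers,
    so it contains just one.\<close>
  have pc: "prefix_count s (i + j * m) = h + 1 + int j * p" if "j \<le> k" for j
  proof -
    have e: "\<beta> + real (i + j * m) * \<alpha> = y + real j * \<delta> + of_int (h + int j * p)"
      by (simp add: y_def \<delta>_def algebra_simps)
    have "real_of_int (h + int j * p) < prefix_count s (i + j * m)"
      "prefix_count s (i + j * m) < real_of_int (h + int j * p) + 2"
      using b[of "i + j * m"] in01[OF that] unfolding e by linarith+
    then show ?thesis by linarith
  qed
  show ?thesis
    by (rule abelian_power_factor[of k s i m p]) (use pc pc[of 0] assms(5) in auto)
qed

text \<open>With \<open>p\<close> the number of \<open>La\<close> in each block, the whole power
  deviates from slope \<alpha> by \<open>k\<close> times the deviation of one block.\<close>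

lemma power_exponent_le:
  assumes "0 < \<alpha>" "\<alpha> < 1" "is_sturmian \<alpha> s" "k \<in> power_exponents s m"
  obtains p :: int where "real k * \<bar>real m * \<alpha> - p\<bar> \<le> 1"
proof -
  obtain w us P where w: "is_factor w s" "w = concat us" "length us = k"
    "\<forall>u\<in>set us. length u = m \<and> parikh u = P"
    using assms(4) unfolding power_exponents_def abelian_power_def by blast
  obtain i where i: "w = map s [i..<i + length w]"
    using w(1) unfolding is_factor_def by blast
  have c: "length w = k * m" "count_list w La = k * fst P"
    using count_concat_const[of us m P] w by auto
  have "int (k * fst P) = prefix_count s (i + k * m) - prefix_count s i"
    using count_factor[of s i "k * m"] i c by metis
  then have "\<bar>real_of_int (int (k * fst P)) - real (k * m) * \<alpha>\<bar> \<le> 1"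
    using factor_count_bound[OF assms(1-3), of i "k * m"] by metis
  then have "\<bar>real k * (real m * \<alpha> - of_int (int (fst P)))\<bar> \<le> 1"
    by (simp add: algebra_simps abs_minus_commute)
  then have "real k * \<bar>real m * \<alpha> - of_int (int (fst P))\<bar> \<le> 1"
    by (simp only: abs_mult abs_of_nat)
  then show ?thesis by (rule that)
qed

lemma max_power_exponent_ge:
  fixes p :: int
  assumes "0 < \<alpha>" "\<alpha> < 1" "\<alpha> \<notin> \<rat>" "is_sturmian \<alpha> s" "m \<ge> 1"
  shows "1 / \<bar>real m * \<alpha> - p\<bar> - 1 \<le> real (max_power_exponent s m)"
proof -
  define d where "d = \<bar>real m * \<alpha> - p\<bar>"
  have d: "d > 0" using irrational_mult_nat[OF assms(3,5), of p] by (simp add: d_def)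
  \<comment> \<open>The largest integer strictly below \<open>1 / d\<close>, as
    \<open>power_exponent_ge\<close> asks for a strict inequality; it is 0 if \<open>d\<close> is at
    least 1.\<close>
  define k where "k = nat (\<lceil>1 / d\<rceil> - 1)"
  have "\<lceil>1 / d\<rceil> \<ge> 1" using d by simp
  then have k: "real k < 1 / d" "1 / d - 1 \<le> real k"
    unfolding k_def by linarith+
  have "k \<le> max_power_exponent s m"
  proof (cases "k \<ge> 1")
    case True
    have "real k * d < 1" using k(1) d by (simp add: field_simps)
    then have "k \<in> power_exponents s m"
      using power_exponent_ge[OF assms(1-4) True] by (simp add: d_def)
    then show ?thesis
      unfolding max_power_exponent_def using finite_power_exponents[OF assms] by (intro Max_ge)
  qed simp
  then show ?thesis using k(2) unfolding d_def by linarith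
qed

lemma max_power_exponent_in:
  assumes "0 < \<alpha>" "\<alpha> < 1" "\<alpha> \<notin> \<rat>" "is_sturmian \<alpha> s" "m \<ge> 1"
  shows "max_power_exponent s m \<in> power_exponents s m"
  unfolding max_power_exponent_def
  using finite_power_exponents[OF assms] abelian_square_exists[OF assms] by (intro Max_in) auto

text \<open>Reindexing along a map tending to infinity cannot raise an upper limit. It serves both
  from periods to convergents and back.\<close>

lemma limsup_le_of_filterlim:
  fixes f g :: "nat \<Rightarrow> ereal"
  assumes "filterlim \<tau> sequentially sequentially" "eventually (\<lambda>n. f n \<le> g (\<tau> n)) sequentially"
  shows "limsup f \<le> limsup g"
  unfolding Limsup_le_iff
proof (intro allI impI)
  fix y assume "limsup g < y"
  then have "eventually (\<lambda>n. g n < y) sequentially" using Limsup_le_iff[of sequentially g "limsup g"] by auto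
  then have "eventually (\<lambda>n. g (\<tau> n) < y) sequentially" 
    using assms(1) by (rule eventually_compose_filterlim)
  with assms(2) show "eventually (\<lambda>n. f n < y) sequentially"
    by eventually_elim auto
qed

section \<open>Upper limits over periods and over convergents\<close>

context pos_cfrac
begin

text \<open>A period between two consecutive denominators is compared with the lower one: its own
  approximation error is no smaller, and neither is the period.\<close>

lemma abelian_critical_exponent_le:
  assumes "0 < cfrac_inf a" "cfrac_inf a < 1" "cfrac_inf a \<notin> \<rat>" "is_sturmian (cfrac_inf a) s"
  shows "abelian_critical_exponent s \<le>
    limsup (\<lambda>i. ereal (1 / (cfrac_den a (Suc i) * \<bar>err (Suc i)\<bar>)))"
proof -
  \<comment> \<open>At \<open>m = 0\<close> no such index exists and the value is arbitrary.\<close>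
  define \<tau> where "\<tau> m = (SOME i. cfrac_den a (Suc i) \<le> int m \<and> int m < cfrac_den a (Suc (Suc i)))" for m
  have \<tau>: "cfrac_den a (Suc (\<tau> m)) \<le> int m" "int m < cfrac_den a (Suc (Suc (\<tau> m)))" if "m \<ge> 1" for m
    using someI_ex[of "\<lambda>i. cfrac_den a (Suc i) \<le> int m \<and> int m < cfrac_den a (Suc (Suc i))"]
      den_bracket[OF that] unfolding \<tau>_def by metis+
  have "filterlim \<tau> sequentially sequentially"
    unfolding filterlim_at_top
  proof
    fix Z
    have "Z \<le> \<tau> m" if m: "m \<ge> max 1 (nat (cfrac_den a (Suc Z)))" for m
    proof (rule ccontr)
      assume "\<not> Z \<le> \<tau> m"
      then have "cfrac_den a (Suc (Suc (\<tau> m))) \<le> cfrac_den a (Suc Z)" by (intro den_mono) simp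
      moreover have "m \<ge> 1" "cfrac_den a (Suc Z) \<le> int m" using m by auto
      ultimately show False using \<tau>(2)[of m] by linarith
    qed
    then show "eventually (\<lambda>m. Z \<le> \<tau> m) sequentially" unfolding eventually_sequentially by blast
  qed
  moreover have "real (max_power_exponent s m) / real m \<le> 1 / (cfrac_den a (Suc (\<tau> m)) * \<bar>err (Suc (\<tau> m))\<bar>)"
    if m: "m \<ge> 1" for m
  proof -
    let ?K = "real (max_power_exponent s m)" and ?q = "real_of_int (cfrac_den a (Suc (\<tau> m)))"
      and ?e = "\<bar>err (Suc (\<tau> m))\<bar>"
    have q: "?q > 0" "?q \<le> real m" using den_pos[of "\<tau> m"] \<tau>(1)[OF m] by linarith+
    have e: "?e > 0" using err_nonzero by simp
    obtain p :: int where p: "?K * \<bar>real m * cfrac_inf a - p\<bar> \<le> 1"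
      using power_exponent_le[OF assms(1,2,4) max_power_exponent_in[OF assms m]] by metis
    have "?e \<le> \<bar>real m * cfrac_inf a - p\<bar>"
      using best_approximation[of "int m" "\<tau> m" p] \<tau>(2)[OF m] m by simp
    then have "?K * ?e \<le> 1" using p mult_left_mono[of ?e _ ?K] by (meson of_nat_0_le_iff order_trans)
    then have "?K \<le> 1 / ?e" using e by (simp add: field_simps)
    then have "?K / real m \<le> (1 / ?e) / ?q" using q e by (intro frac_le) auto
    then show ?thesis by (simp add: mult.commute)
  qed
  ultimately show ?thesis
    unfolding abelian_critical_exponent_def
    by (intro limsup_le_of_filterlim[of \<tau>]) (auto simp: eventually_sequentially)
qed

text \<open>Denominators serve as periods; the loss of 1 in \<open>max_power_exponent_ge\<close>
  vanishes after division by the period.\<close>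

lemma abelian_critical_exponent_ge:
  assumes "0 < cfrac_inf a" "cfrac_inf a < 1" "cfrac_inf a \<notin> \<rat>" "is_sturmian (cfrac_inf a) s"
  shows "limsup (\<lambda>i. ereal (1 / (cfrac_den a (Suc i) * \<bar>err (Suc i)\<bar>)))
    \<le> abelian_critical_exponent s"
proof -
  define q where "q i = nat (cfrac_den a (Suc i))" for i
  have q: "real (q i) = cfrac_den a (Suc i)" "q i \<ge> 1" "q i \<ge> i" for i
    using den_pos[of i] den_ge[of i] by (auto simp: q_def)
  have lim: "filterlim q sequentially sequentially"
    using q(3) by (auto simp: filterlim_at_top eventually_sequentially intro: order_trans)
  let ?f = "\<lambda>m. ereal (real (max_power_exponent s m) / real m)"
  have "1 / (cfrac_den a (Suc i) * \<bar>err (Suc i)\<bar>) \<le> 1 / real (q i) + real (max_power_exponent s (q i)) / real (q i)" for i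
  proof -
    have "1 / \<bar>err (Suc i)\<bar> - 1 \<le> real (max_power_exponent s (q i))"
      using max_power_exponent_ge[OF assms q(2), of i "cfrac_num a (Suc i)"] by (simp add: err_def q(1))
    then have "(1 / \<bar>err (Suc i)\<bar>) / real (q i) \<le> (1 + real (max_power_exponent s (q i))) / real (q i)"
      by (intro divide_right_mono) auto
    then show ?thesis using q(1)[of i] by (simp add: add_divide_distrib mult.commute)
  qed
  then have "limsup (\<lambda>i. ereal (1 / (cfrac_den a (Suc i) * \<bar>err (Suc i)\<bar>)))
      \<le> limsup (\<lambda>m. ereal (1 / real m) + ?f m)"
    by (intro limsup_le_of_filterlim[OF lim]) auto
  also have "\<dots> = 0 + limsup ?f"
  proof (rule ereal_limsup_lim_add)
    have "(\<lambda>m. 1 / real m) \<longlonglongrightarrow> 0" by (rule lim_const_over_n)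
    then show "(\<lambda>m. ereal (1 / real m)) \<longlonglongrightarrow> 0" by (simp add: zero_ereal_def)
  qed simp
  finally show ?thesis by (simp add: abelian_critical_exponent_def)
qed

end

theorem proposition5p12:
  fixes \<alpha> :: real and a :: "nat \<Rightarrow> int" and s :: "nat \<Rightarrow> letter"
  assumes "0 < \<alpha>" and "\<alpha> < 1" and "\<alpha> \<notin> \<rat>"
    and "\<And>i. i \<ge> 1 \<Longrightarrow> a i \<ge> 1"
    and "\<alpha> = cfrac_inf a"
    and "is_sturmian \<alpha> s"
  shows "abelian_critical_exponent s =
    limsup (\<lambda>i. ereal (cfrac_inf (\<lambda>n. a (i + 1 + n)) + cfrac_fin (0 # map a (rev [1..<i + 1]))))"
proof -
  interpret pos_cfrac a by unfold_locales (rule assms(4))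
  have "cfrac_inf (\<lambda>n. a (i + 1 + n)) + cfrac_fin (0 # map a (rev [1..<i + 1]))
      = 1 / (cfrac_den a (Suc i) * \<bar>err (Suc i)\<bar>)" for i
    unfolding inverse_den_err den_ratio quot_def by simp
  then show ?thesis
    using abelian_critical_exponent_le abelian_critical_exponent_ge assms by (auto intro!: antisym)
qed

end
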